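(* Let $(X,\mathcal{E})$ be an entourage space. (a) There exists an extended semi-positive-definite map $d$ on $X$ such that $\mathcal{E}=\mathcal{E}_d$ if and only if $\operatorname{cf}\mathcal{E}\le\omega$. (b) Suppose that $\mathcal{E}$ is a semi-coarse structure. Then there exists an extended semi-metric $d$ on $X$ such that $\mathcal{E}=\mathcal{E}_d$ if and only if $\operatorname{cf}\mathcal{E}\le\omega$.
   Context: Put $\Delta_X=\{(x,x)\mid x\in X\}$ and $E^{-1}=\{(x,y)\mid (y,x)\in E\}$. An entourage structure on a set $X$ is a family $\mathcal{E}$ of subsets of $X\times X$ closed under subsets and finite unions with $\Delta_X\in\mathcal{E}$; $(X,\mathcal{E})$ is then an entourage space. It is a semi-coarse structure if $E^{-1}\in\mathcal{E}$ for every $E\in\mathcal{E}$. For a family $\mathcal{B}$ of sets, $\widehat{\mathcal{B}}$ is the family of all subsets of members of $\mathcal{B}$; the cofinality is $\operatorname{cf}\mathcal{E}=\inf\{|\mathcal{B}|\mid\widehat{\mathcal{B}}=\mathcal{E}\}$. An extended semi-positive-definite map on $X$ is a map $d\colon X\times X\to[0,\infty]$ with $d(x,x)=0$ for every $x\in X$. It is an extended semi-metric if moreover $d(x,y)=d(y,x)$ for all $x,y$ and $x=y$ whenever $d(x,y)=0$ (no triangle inequality is required). For such $d$, $\mathcal{E}_d=\widehat{\{E_R\mid R\ge0\}}$, where $E_R=\{(x,y)\in X\times X\mid d(x,y)\le R\}$. *)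

theory Defs
  imports Complex_Main "HOL-Library.Extended_Nonnegative_Real"
begin

unbundle cardinal_syntax

definition entourage_structure :: "'a set \<Rightarrow> ('a \<times> 'a) set set \<Rightarrow> bool" where
  "entourage_structure X \<E> \<longleftrightarrow>
     \<E> \<subseteq> Pow (X \<times> X) \<and>
     (\<forall>E\<in>\<E>. \<forall>F. F \<subseteq> E \<longrightarrow> F \<in> \<E>) \<and>
     (\<forall>\<F>. finite \<F> \<and> \<F> \<subseteq> \<E> \<longrightarrow> \<Union>\<F> \<in> \<E>) \<and>
     Id_on X \<in> \<E>"

definition semi_coarse_structure :: "'a set \<Rightarrow> ('a \<times> 'a) set set \<Rightarrow> bool" where
  "semi_coarse_structure X \<E> \<longleftrightarrow>
     entourage_structure X \<E> \<and> (\<forall>E\<in>\<E>. E\<inverse> \<in> \<E>)"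

definition down_closure :: "'b set set \<Rightarrow> 'b set set" where
  "down_closure \<B> = {A. \<exists>B\<in>\<B>. A \<subseteq> B}"

(* Cardinals are well-orders up to the isomorphism =o. The infimum of the cardinalities
   is therefore represented by some |B| that is least, with respect to \<le>o, among all
   generating families; existence is shown in the lemma below. *)
definition is_cofinality :: "'b set set \<Rightarrow> 'b set rel \<Rightarrow> bool" where
  "is_cofinality \<E> r \<longleftrightarrow>
     (\<exists>\<B>. down_closure \<B> = \<E> \<and> r = |\<B>| ) \<and>
     (\<forall>\<B>. down_closure \<B> = \<E> \<longrightarrow> r \<le>o |\<B>| )"

definition cofinality :: "'b set set \<Rightarrow> 'b set rel" where
  "cofinality \<E> = (SOME r. is_cofinality \<E> r)"

lemma is_cofinality_cofinality:
  assumes "\<And>E F. E \<in> \<E> \<Longrightarrow> F \<subseteq> E \<Longrightarrow> F \<in> \<E>"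
  shows "is_cofinality \<E> (cofinality \<E>)"
proof -
  let ?R = "{|\<B>| | \<B>. down_closure \<B> = \<E>}"
  have "down_closure \<E> = \<E>"
    using assms by (auto simp: down_closure_def)
  then have "?R \<noteq> {}" by blast
  moreover have "\<forall>r\<in>?R. Card_order r"
    by (auto simp: card_of_Card_order)
  ultimately have "\<exists>r\<in>?R. \<forall>r'\<in>?R. r \<le>o r'"
    by (rule exists_minim_Card_order)
  then have "\<exists>r. is_cofinality \<E> r"
    unfolding is_cofinality_def by blast
  then show ?thesis
    unfolding cofinality_def by (rule someI_ex)
qed

definition extended_semi_positive_definite :: "'a set \<Rightarrow> ('a \<Rightarrow> 'a \<Rightarrow> ennreal) \<Rightarrow> bool" where
  "extended_semi_positive_definite X d \<longleftrightarrow> (\<forall>x\<in>X. d x x = 0)"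

definition extended_semi_metric :: "'a set \<Rightarrow> ('a \<Rightarrow> 'a \<Rightarrow> ennreal) \<Rightarrow> bool" where
  "extended_semi_metric X d \<longleftrightarrow>
     extended_semi_positive_definite X d \<and>
     (\<forall>x\<in>X. \<forall>y\<in>X. d x y = d y x) \<and>
     (\<forall>x\<in>X. \<forall>y\<in>X. d x y = 0 \<longrightarrow> x = y)"

definition dist_entourage :: "'a set \<Rightarrow> ('a \<Rightarrow> 'a \<Rightarrow> ennreal) \<Rightarrow> real \<Rightarrow> ('a \<times> 'a) set" where
  "dist_entourage X d R = {(x, y). x \<in> X \<and> y \<in> X \<and> d x y \<le> ennreal R}"

(* The radius R is a finite real: R = \<infinity> would always make X \<times> X an entourage. *)
definition induced_structure :: "'a set \<Rightarrow> ('a \<Rightarrow> 'a \<Rightarrow> ennreal) \<Rightarrow> ('a \<times> 'a) set set" where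
  "induced_structure X d = down_closure {dist_entourage X d R | R. R \<ge> 0}"

end

theory Submission
  imports Defs "HOL-Library.Countable_Set"
begin

text \<open>
  The entourages of integer radius form a countable generating family of the structure of \<open>d\<close>.
  Conversely, the finite unions of a countable generating family, together with the diagonal, form
  an increasing sequence \<open>F\<^sub>0 \<subseteq> F\<^sub>1 \<subseteq> \<dots>\<close> with \<open>F\<^sub>0 = \<Delta>\<^sub>X\<close>, and \<open>d(x,y)\<close> is the least \<open>n\<close> with
  \<open>(x,y) \<in> F\<^sub>n\<close>. In the semi-coarse case each \<open>F\<^sub>n\<close> is replaced by its symmetrization, which
  makes \<open>d\<close> symmetric.
\<close>

text \<open>The infimum defining \<open>cofinality\<close> is attained: closure under subsets makes
  it the cardinality of an actual generating family. A bound by \<open>natLeq\<close> therefore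
  makes that very family countable, and the converse is minimality.\<close>

lemma cofinality_le_natLeq_iff:
  assumes "\<And>E F. E \<in> \<E> \<Longrightarrow> F \<subseteq> E \<Longrightarrow> F \<in> \<E>"
  shows "cofinality \<E> \<le>o natLeq \<longleftrightarrow> (\<exists>\<B>. countable \<B> \<and> down_closure \<B> = \<E>)"
proof -
  have countable_iff: "countable \<B> \<longleftrightarrow> |\<B>| \<le>o natLeq" for \<B> :: "'a set set"
  proof -
    have "countable \<B> \<longleftrightarrow> |\<B>| \<le>o |UNIV :: nat set|"
      using card_of_ordLeq[of \<B> "UNIV :: nat set"] by (simp add: countable_def)
    then show ?thesis
      using card_of_nat by (metis ordIso_symmetric ordLeq_ordIso_trans)
  qed
  have "is_cofinality \<E> (cofinality \<E>)"
    using assms by (rule is_cofinality_cofinality)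
  then obtain \<B> where \<B>: "down_closure \<B> = \<E>" "cofinality \<E> = |\<B>|"
    and le: "\<And>\<C>. down_closure \<C> = \<E> \<Longrightarrow> cofinality \<E> \<le>o |\<C>|"
    unfolding is_cofinality_def by auto
  show ?thesis
  proof
    assume "cofinality \<E> \<le>o natLeq"
    then show "\<exists>\<B>. countable \<B> \<and> down_closure \<B> = \<E>"
      using \<B> countable_iff by auto
  next
    assume "\<exists>\<B>. countable \<B> \<and> down_closure \<B> = \<E>"
    then obtain \<C> where "|\<C>| \<le>o natLeq" "down_closure \<C> = \<E>"
      using countable_iff by blast
    then show "cofinality \<E> \<le>o natLeq"
      using le ordLeq_transitive by blast
  qed
qed

text \<open>Rounding a radius up to an integer only enlarges the entourage, so the integer radii are
  cofinal among all finite ones. This supplies the countable generating family, and it lets the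
  converse inspect only integer radii.\<close>

lemma induced_structure_eq_nat:
  "induced_structure X d = down_closure (range (\<lambda>n. dist_entourage X d (real n)))"
proof -
  have "dist_entourage X d R \<subseteq> dist_entourage X d (real (nat \<lceil>R\<rceil>))" for R
  proof -
    have "ennreal R \<le> ennreal (real (nat \<lceil>R\<rceil>))"
      by (intro ennreal_leI real_nat_ceiling_ge)
    then show ?thesis
      by (auto simp: dist_entourage_def intro: order_trans)
  qed
  moreover have "real n \<ge> 0" for n
    by simp
  ultimately show ?thesis
    unfolding induced_structure_def down_closure_def by blast
qed

text \<open>A pair that lies in no \<open>F n\<close> gets the infimum of the empty set, which in
  \<open>ennreal\<close> is the top element, so its distance is infinite.\<close>

definition level_dist :: "(nat \<Rightarrow> ('a \<times> 'a) set) \<Rightarrow> 'a \<Rightarrow> 'a \<Rightarrow> ennreal" where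
  "level_dist F x y = (INF n\<in>{n. (x, y) \<in> F n}. of_nat n)"

lemma level_dist_le_of_nat_iff:
  assumes "mono F"
  shows "level_dist F x y \<le> of_nat n \<longleftrightarrow> (x, y) \<in> F n"
proof
  assume "(x, y) \<in> F n"
  then show "level_dist F x y \<le> of_nat n"
    unfolding level_dist_def by (intro INF_lower) simp
next
  assume le: "level_dist F x y \<le> of_nat n"
  show "(x, y) \<in> F n"
  proof (rule ccontr)
    \<comment> \<open>As \<open>F\<close> increases, a pair missing from \<open>F n\<close> is
      missing from all earlier levels too. Hence every index in the infimum is at least
      \<open>Suc n\<close>, and this gap of one survives the passage to the infimum.\<close>
    assume "(x, y) \<notin> F n"
    then have "Suc n \<le> m" if "(x, y) \<in> F m" for m
      using that monoD[OF assms, of m n] by (metis not_less_eq_eq subsetD)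
    then have "of_nat (Suc n) \<le> level_dist F x y"
      unfolding level_dist_def by (intro INF_greatest) (simp del: of_nat_Suc)
    with le have "(of_nat (Suc n) :: ennreal) \<le> of_nat n"
      by (rule order_trans[rotated])
    then show False
      by (simp del: of_nat_Suc)
  qed
qed

lemma level_dist_eq_0_iff:
  assumes "mono F"
  shows "level_dist F x y = 0 \<longleftrightarrow> (x, y) \<in> F 0"
  using level_dist_le_of_nat_iff[OF assms, of x y 0] by simp

lemma level_dist_commute:
  assumes "\<And>n. sym (F n)"
  shows "level_dist F x y = level_dist F y x"
proof -
  have "{n. (x, y) \<in> F n} = {n. (y, x) \<in> F n}"
    using assms by (auto dest: symD)
  then show ?thesis
    by (simp add: level_dist_def)
qed

text \<open>The entourage of radius \<open>n\<close> is exactly \<open>F n\<close>, and integer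
  radii suffice to generate the structure.\<close>

lemma induced_structure_level_dist:
  assumes "mono F" "\<And>n. F n \<subseteq> X \<times> X"
  shows "induced_structure X (level_dist F) = down_closure (range F)"
proof -
  have "dist_entourage X (level_dist F) (real n) = F n" for n
    using assms(2)[of n] level_dist_le_of_nat_iff[OF assms(1), of _ _ n]
    by (auto simp: dist_entourage_def ennreal_of_nat_eq_real_of_nat)
  then show ?thesis
    by (simp add: induced_structure_eq_nat)
qed

lemma entourage_structure_Un:
  assumes "entourage_structure X \<E>" "E \<in> \<E>" "F \<in> \<E>"
  shows "E \<union> F \<in> \<E>"
proof -
  have "finite {E, F} \<and> {E, F} \<subseteq> \<E>"
    using assms(2,3) by simp
  then have "\<Union>{E, F} \<in> \<E>"
    using assms(1) unfolding entourage_structure_def by blast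
  then show ?thesis
    by simp
qed

text \<open>One inclusion is closure of \<E> under subsets, the other is cofinality of \<A>. Both
  chains constructed below are checked by this criterion.\<close>

lemma down_closure_cofinal_eq:
  assumes "entourage_structure X \<E>" "\<A> \<subseteq> \<E>" "\<And>E. E \<in> \<E> \<Longrightarrow> \<exists>A\<in>\<A>. E \<subseteq> A"
  shows "down_closure \<A> = \<E>"
proof
  have "F \<in> \<E>" if "E \<in> \<E>" "F \<subseteq> E" for E F
    using assms(1) that by (simp add: entourage_structure_def)
  then show "down_closure \<A> \<subseteq> \<E>"
    using assms(2) by (auto simp: down_closure_def)
  show "\<E> \<subseteq> down_closure \<A>"
    using assms(3) by (auto simp: down_closure_def)
qed

lemma entourage_structure_chain:
  assumes str: "entourage_structure X \<E>" and "countable \<B>" "down_closure \<B> = \<E>"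
  obtains F :: "nat \<Rightarrow> ('a \<times> 'a) set"
  where "mono F" "F 0 = Id_on X" "down_closure (range F) = \<E>"
proof
  let ?b = "from_nat_into \<B>"
  \<comment> \<open>The strict bound \<open>i<n\<close> leaves level 0 equal to the diagonal, so
    that the resulting distance vanishes exactly there on X.\<close>
  let ?F = "\<lambda>n. Id_on X \<union> (\<Union>i<n. ?b i)"
  have Id: "Id_on X \<in> \<E>"
    using str by (simp add: entourage_structure_def)
  \<comment> \<open>\<open>from_nat_into\<close> enumerates only nonempty sets. Here some member of
    \<B> has to contain the diagonal, which is an entourage even when X is empty.\<close>
  then have "\<B> \<noteq> {}"
    using assms(3) by (auto simp: down_closure_def)
  then have range_b: "range ?b = \<B>"
    using assms(2) by (rule range_from_nat_into)
  have "\<B> \<subseteq> \<E>"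
    using assms(3) by (auto simp: down_closure_def)
  show "mono ?F"
    by (intro monoI Un_mono UN_mono) auto
  show "?F 0 = Id_on X"
    by simp
  show "down_closure (range ?F) = \<E>"
  proof (rule down_closure_cofinal_eq[OF str])
    have "(\<Union>i<n. ?b i) \<in> \<E>" for n
    proof -
      have "finite (?b ` {..<n}) \<and> ?b ` {..<n} \<subseteq> \<E>"
        using range_b \<open>\<B> \<subseteq> \<E>\<close> by auto
      then show ?thesis
        using str unfolding entourage_structure_def by blast
    qed
    then show "range ?F \<subseteq> \<E>"
      using entourage_structure_Un[OF str Id] by auto
    fix E assume "E \<in> \<E>"
    then obtain B where "B \<in> \<B>" "E \<subseteq> B"
      using assms(3) by (auto simp: down_closure_def)
    then obtain n where "E \<subseteq> ?b n"
      using range_b by (metis rangeE)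
    \<comment> \<open>The index shifts by one because \<open>?b n\<close> first enters the union at
      level \<open>Suc n\<close>.\<close>
    then have "E \<subseteq> ?F (Suc n)"
      by auto
    then show "\<exists>A\<in>range ?F. E \<subseteq> A"
      by blast
  qed
qed

text \<open>Symmetrizing each level preserves monotonicity, cofinality and the diagonal at level 0.
  The levels remain entourages because \<E> is closed under inverses and binary unions.\<close>

lemma semi_coarse_structure_sym_chain:
  assumes semi: "semi_coarse_structure X \<E>" and "countable \<B>" "down_closure \<B> = \<E>"
  obtains F :: "nat \<Rightarrow> ('a \<times> 'a) set"
  where "mono F" "F 0 = Id_on X" "down_closure (range F) = \<E>" "\<And>n. sym (F n)"
proof -
  have str: "entourage_structure X \<E>"
    using semi by (simp add: semi_coarse_structure_def)
  obtain F :: "nat \<Rightarrow> ('a \<times> 'a) set"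
    where F: "mono F" "F 0 = Id_on X" "down_closure (range F) = \<E>"
    using entourage_structure_chain[OF str assms(2,3)] .
  show ?thesis
  proof (rule that[of "\<lambda>n. F n \<union> (F n)\<inverse>"])
    show "mono (\<lambda>n. F n \<union> (F n)\<inverse>)"
      by (rule monoI) (use F(1) in \<open>auto dest!: monoD\<close>)
    show "F 0 \<union> (F 0)\<inverse> = Id_on X"
      using F(2) by auto
    show "sym (F n \<union> (F n)\<inverse>)" for n
      by (auto intro: symI)
    show "down_closure (range (\<lambda>n. F n \<union> (F n)\<inverse>)) = \<E>"
    proof (rule down_closure_cofinal_eq[OF str])
      have "F n \<in> \<E>" for n
        using F(3) by (auto simp: down_closure_def)
      then show "range (\<lambda>n. F n \<union> (F n)\<inverse>) \<subseteq> \<E>"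
        using semi entourage_structure_Un[OF str] by (auto simp: semi_coarse_structure_def)
      show "\<exists>A\<in>range (\<lambda>n. F n \<union> (F n)\<inverse>). E \<subseteq> A" if "E \<in> \<E>" for E
        using that F(3) unfolding down_closure_def by blast
    qed
  qed
qed

lemma induced_structure_level_dist_chain:
  assumes "entourage_structure X \<E>" "mono F" "down_closure (range F) = \<E>"
  shows "induced_structure X (level_dist F) = \<E>"
proof -
  have "F n \<in> \<E>" for n
    using assms(3) by (auto simp: down_closure_def)
  then have "F n \<subseteq> X \<times> X" for n
    using assms(1) unfolding entourage_structure_def by blast
  then show ?thesis
    using induced_structure_level_dist assms(2,3) by blast
qed

theorem proposition1p5:
  fixes X :: "'a set" and \<E> :: "('a \<times> 'a) set set"
  assumes "entourage_structure X \<E>"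
  shows "((\<exists>d. extended_semi_positive_definite X d \<and> \<E> = induced_structure X d)
            \<longleftrightarrow> cofinality \<E> \<le>o natLeq) \<and>
         (semi_coarse_structure X \<E> \<longrightarrow>
            ((\<exists>d. extended_semi_metric X d \<and> \<E> = induced_structure X d)
              \<longleftrightarrow> cofinality \<E> \<le>o natLeq))"
proof -
  have cof: "cofinality \<E> \<le>o natLeq \<longleftrightarrow> (\<exists>\<B>. countable \<B> \<and> down_closure \<B> = \<E>)"
    by (rule cofinality_le_natLeq_iff) (use assms in \<open>auto simp: entourage_structure_def\<close>)
  have induced: "cofinality \<E> \<le>o natLeq" if "\<E> = induced_structure X d" for d
  proof -
    let ?\<B> = "range (\<lambda>n. dist_entourage X d (real n))"
    have "countable ?\<B> \<and> down_closure ?\<B> = \<E>"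
      by (simp add: that induced_structure_eq_nat)
    then show ?thesis
      unfolding cof by (rule exI)
  qed
  have "\<exists>d. extended_semi_positive_definite X d \<and> \<E> = induced_structure X d"
    if le: "cofinality \<E> \<le>o natLeq"
  proof -
    obtain \<B> where \<B>: "countable \<B>" "down_closure \<B> = \<E>"
      using le cof by blast
    obtain F :: "nat \<Rightarrow> ('a \<times> 'a) set"
      where F: "mono F" "F 0 = Id_on X" "down_closure (range F) = \<E>"
      using entourage_structure_chain[OF assms \<B>] .
    have "extended_semi_positive_definite X (level_dist F)"
      using F by (auto simp: extended_semi_positive_definite_def level_dist_eq_0_iff)
    then show ?thesis
      using induced_structure_level_dist_chain[OF assms F(1,3)] by blast
  qed
  moreover have "\<exists>d. extended_semi_metric X d \<and> \<E> = induced_structure X d"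
    if semi: "semi_coarse_structure X \<E>" and le: "cofinality \<E> \<le>o natLeq"
  proof -
    obtain \<B> where \<B>: "countable \<B>" "down_closure \<B> = \<E>"
      using le cof by blast
    obtain F :: "nat \<Rightarrow> ('a \<times> 'a) set"
      where F: "mono F" "F 0 = Id_on X" "down_closure (range F) = \<E>"
      and sym: "\<And>n. sym (F n)"
      using semi_coarse_structure_sym_chain[OF semi \<B>] by blast
    \<comment> \<open>Since level 0 is the diagonal, \<open>level_dist_eq_0_iff\<close> yields both
      that the distance is zero on the diagonal and that distinct points are separated. Symmetry of
      the levels gives symmetry of the distance.\<close>
    have "extended_semi_metric X (level_dist F)"
      unfolding extended_semi_metric_def extended_semi_positive_definite_def
        level_dist_eq_0_iff[OF F(1)] F(2)
      by (intro conjI ballI level_dist_commute sym) auto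
    then show ?thesis
      using induced_structure_level_dist_chain[OF assms F(1,3)] by blast
  qed
  ultimately show ?thesis
    using induced by blast
qed

end
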